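(* Let $G_1$ and $G_2$ be finite simple undirected graphs, and let $G_1\wedge G_2$ denote their corona. Let $m_1=\max(\operatorname{nlcw}(G_1),\operatorname{nlcw}(G_2))$ and $m_2=\max(\operatorname{cw}(G_1),\operatorname{cw}(G_2))$. Then \[m_1\le \operatorname{nlcw}(G_1\wedge G_2)\le m_1+1\quad\text{and}\quad m_2\le \operatorname{cw}(G_1\wedge G_2)\le m_2+1.\]
   Context: Corona: $G_1\wedge G_2$ is the disjoint union of one copy of $G_1$ and $|V_{G_1}|$ copies of $G_2$, where additionally the $i$-th vertex of the copy of $G_1$ is joined by edges to all vertices of the $i$-th copy of $G_2$ (a bijection between vertices of $G_1$ and copies of $G_2$). Clique-width: for a positive integer $k$, $\mathrm{CW}_k$ is the smallest class of graphs whose vertices carry labels from $\{1,\dots,k\}$ that contains every single-vertex graph with any label and is closed under: disjoint union of two vertex-disjoint labeled graphs; relabeling $\rho_{a\to b}$ for $a\neq b$ (every vertex labeled $a$ gets label $b$); and $\eta_{a,b}$ for $a\neq b$ (add all edges between vertices labeled $a$ and vertices labeled $b$). $\operatorname{cw}(G)$ is the least $k$ such that some labeling of $G$ lies in $\mathrm{CW}_k$. NLC-width: $\mathrm{NLC}_k$ is the smallest class of labeled graphs (labels in $\{1,\dots,k\}$) containing every single-vertex graph with any label and closed under: $G\times_S J$ for $S\subseteq\{1,\dots,k\}^2$ (disjoint union of vertex-disjoint $G$ and $J$ plus all edges $\{u,v\}$, $u\in V_G$, $v\in V_J$, $(\mathrm{lab}(u),\mathrm{lab}(v))\in S$); and $\circ_R$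 for $R:\{1,\dots,k\}\to\{1,\dots,k\}$ (each label $a$ replaced by $R(a)$). $\operatorname{nlcw}(G)$ is the least $k$ such that some labeling of $G$ lies in $\mathrm{NLC}_k$. *)

theory Defs
  imports "Graph_Theory.Pair_Digraph"
begin

text \<open>
  Finite simple undirected graphs are \<^locale>\<open>pair_graph\<close>s: an edge between \<open>u\<close> and \<open>v\<close> is the
  pair of arcs \<open>(u, v)\<close>, \<open>(v, u)\<close>. A labeled graph is a pair \<open>(G, lab)\<close>; the values of \<open>lab\<close>
  outside \<open>pverts G\<close> carry no meaning.
\<close>

type_synonym 'v labeled_graph = "'v pair_pre_digraph \<times> ('v \<Rightarrow> nat)"

definition single_vertex :: "'v \<Rightarrow> 'v pair_pre_digraph" where
  "single_vertex v = \<lparr>pverts = {v}, parcs = {}\<rparr>"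

definition graph_union :: "'v pair_pre_digraph \<Rightarrow> 'v pair_pre_digraph \<Rightarrow> 'v pair_pre_digraph" where
  "graph_union G J = \<lparr>pverts = pverts G \<union> pverts J, parcs = parcs G \<union> parcs J\<rparr>"

definition join_labels ::
  "'v pair_pre_digraph \<Rightarrow> ('v \<Rightarrow> nat) \<Rightarrow> ('v \<Rightarrow> nat) \<Rightarrow> 'v \<Rightarrow> nat" where
  "join_labels G l l' = (\<lambda>v. if v \<in> pverts G then l v else l' v)"

definition add_edges :: "'v pair_pre_digraph \<Rightarrow> 'v rel \<Rightarrow> 'v pair_pre_digraph" where
  "add_edges G E = \<lparr>pverts = pverts G, parcs = parcs G \<union> E \<union> E\<inverse>\<rparr>"

inductive_set CW :: "nat \<Rightarrow> 'v labeled_graph set" for k :: nat where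
  CW_vertex: "l v \<in> {1..k} \<Longrightarrow> (single_vertex v, l) \<in> CW k"
| CW_union: "\<lbrakk>(G, l) \<in> CW k; (J, l') \<in> CW k; pverts G \<inter> pverts J = {}\<rbrakk>
    \<Longrightarrow> (graph_union G J, join_labels G l l') \<in> CW k"
| CW_relabel: "\<lbrakk>(G, l) \<in> CW k; a \<in> {1..k}; b \<in> {1..k}; a \<noteq> b\<rbrakk>
    \<Longrightarrow> (G, \<lambda>v. if l v = a then b else l v) \<in> CW k"
| CW_join: "\<lbrakk>(G, l) \<in> CW k; a \<in> {1..k}; b \<in> {1..k}; a \<noteq> b\<rbrakk>
    \<Longrightarrow> (add_edges G {(u, v). u \<in> pverts G \<and> v \<in> pverts G \<and> l u = a \<and> l v = b}, l) \<in> CW k"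

inductive_set NLC :: "nat \<Rightarrow> 'v labeled_graph set" for k :: nat where
  NLC_vertex: "l v \<in> {1..k} \<Longrightarrow> (single_vertex v, l) \<in> NLC k"
| NLC_union: "\<lbrakk>(G, l) \<in> NLC k; (J, l') \<in> NLC k; pverts G \<inter> pverts J = {};
     S \<subseteq> {1..k} \<times> {1..k}\<rbrakk>
    \<Longrightarrow> (add_edges (graph_union G J)
           {(u, v). u \<in> pverts G \<and> v \<in> pverts J \<and> (l u, l' v) \<in> S},
         join_labels G l l') \<in> NLC k"
| NLC_relabel: "\<lbrakk>(G, l) \<in> NLC k; R ` {1..k} \<subseteq> {1..k}\<rbrakk> \<Longrightarrow> (G, R \<circ> l) \<in> NLC k"

text \<open>
  Both widths are meaningful for finite nonempty graphs only: the empty graph has no labeling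
  in any of the classes.
\<close>

definition clique_width :: "'v pair_pre_digraph \<Rightarrow> nat" where
  "clique_width G = (LEAST k. 0 < k \<and> (\<exists>l. (G, l) \<in> CW k))"

definition nlc_width :: "'v pair_pre_digraph \<Rightarrow> nat" where
  "nlc_width G = (LEAST k. 0 < k \<and> (\<exists>l. (G, l) \<in> NLC k))"

text \<open>
  \<open>Inl x\<close> is the vertex \<open>x\<close> of \<open>G1\<close>, and \<open>Inr (x, y)\<close> is the vertex \<open>y\<close> in the copy of \<open>G2\<close>
  assigned to \<open>x\<close>.
\<close>

definition corona ::
  "'a pair_pre_digraph \<Rightarrow> 'b pair_pre_digraph \<Rightarrow> ('a + 'a \<times> 'b) pair_pre_digraph" where
  "corona G1 G2 = add_edges
     \<lparr>pverts = Inl ` pverts G1 \<union> Inr ` (pverts G1 \<times> pverts G2),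
      parcs = {(Inl x, Inl x') | x x'. (x, x') \<in> parcs G1} \<union>
              {(Inr (x, y), Inr (x, y')) | x y y'. x \<in> pverts G1 \<and> (y, y') \<in> parcs G2}\<rparr>
     {(Inl x, Inr (x, y)) | x y. x \<in> pverts G1 \<and> y \<in> pverts G2}"

end

theory Submission
  imports Defs
begin

text \<open>
  Lower bounds: \<open>G1\<close> and \<open>G2\<close> are isomorphic to induced subgraphs of the corona, and restricting
  every step of a construction to a subset of the vertices never needs additional labels.

  Upper bounds: follow a construction of \<open>G1\<close> with labels below \<open>K = m + 1\<close>, but replace each
  single vertex \<open>x\<close> by \<open>x\<close> joined to a complete copy of \<open>G2\<close> whose vertices have all been relabeled
  to \<open>K\<close>. As no later step touches the label \<open>K\<close>, the result is the corona.
\<close>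

section \<open>Labelings up to values outside the graph\<close>

text \<open>
  Since the labels outside the vertex set are arbitrary but not freely changeable within \<open>CW k\<close>
  and \<open>NLC k\<close>, these classes are closed under their operations in a usable form only modulo
  agreement on the vertices.
\<close>

definition constructible :: "'v labeled_graph set \<Rightarrow> 'v pair_pre_digraph \<Rightarrow> ('v \<Rightarrow> nat) \<Rightarrow> bool" where
  "constructible C G l \<longleftrightarrow> (\<exists>l'. (G, l') \<in> C \<and> (\<forall>v\<in>pverts G. l' v = l v))"

lemma constructible_cong:
  assumes "constructible C G l" "G = H" "\<And>v. v \<in> pverts G \<Longrightarrow> l v = l' v"
  shows "constructible C H l'"
  using assms unfolding constructible_def by metis

lemma constructible_mem: "(G, l) \<in> C \<Longrightarrow> constructible C G l"
  unfolding constructible_def by blast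

lemmas graph_simps = single_vertex_def graph_union_def add_edges_def

section \<open>Closure under the operations, modulo agreement on the vertices\<close>

lemma constructible_CW_vertex: "l v \<in> {1..k} \<Longrightarrow> constructible (CW k) (single_vertex v) l"
  by (intro constructible_mem CW_vertex)

text \<open>One labeling \<open>l\<close> can serve both operands: by disjointness, joining two
  labelings that agree with \<open>l\<close> on their own parts agrees with \<open>l\<close> on the
  union, so \<open>join_labels\<close> disappears.\<close>

lemma constructible_CW_union:
  assumes "constructible (CW k) G l" "constructible (CW k) J l" "pverts G \<inter> pverts J = {}"
  shows "constructible (CW k) (graph_union G J) l"
proof -
  obtain l1 l2 where 1: "(G, l1) \<in> CW k" "\<forall>v\<in>pverts G. l1 v = l v"
    and 2: "(J, l2) \<in> CW k" "\<forall>v\<in>pverts J. l2 v = l v"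
    using assms unfolding constructible_def by blast
  from constructible_mem[OF CW_union[OF 1(1) 2(1) assms(3)]] show ?thesis
    by (rule constructible_cong) (use 1 2 in \<open>auto simp: join_labels_def graph_union_def\<close>)
qed

lemma constructible_CW_relabel:
  assumes "constructible (CW k) G l" "a \<in> {1..k}" "b \<in> {1..k}" "a \<noteq> b"
  shows "constructible (CW k) G (\<lambda>v. if l v = a then b else l v)"
proof -
  obtain l1 where 1: "(G, l1) \<in> CW k" "\<forall>v\<in>pverts G. l1 v = l v"
    using assms unfolding constructible_def by blast
  from constructible_mem[OF CW_relabel[OF 1(1) assms(2-4)]] show ?thesis
    by (rule constructible_cong) (use 1 in auto)
qed

lemma constructible_CW_join:
  assumes "constructible (CW k) G l" "a \<in> {1..k}" "b \<in> {1..k}" "a \<noteq> b"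
  shows "constructible (CW k)
    (add_edges G {(u, v). u \<in> pverts G \<and> v \<in> pverts G \<and> l u = a \<and> l v = b}) l"
proof -
  obtain l1 where 1: "(G, l1) \<in> CW k" "\<forall>v\<in>pverts G. l1 v = l v"
    using assms unfolding constructible_def by blast
  from constructible_mem[OF CW_join[OF 1(1) assms(2-4)]] show ?thesis
    by (rule constructible_cong) (use 1 in \<open>auto simp: add_edges_def\<close>)
qed

lemma constructible_NLC_vertex: "l v \<in> {1..k} \<Longrightarrow> constructible (NLC k) (single_vertex v) l"
  by (intro constructible_mem NLC_vertex)

lemma constructible_NLC_union:
  assumes "constructible (NLC k) G l" "constructible (NLC k) J l" "pverts G \<inter> pverts J = {}"
    and "S \<subseteq> {1..k} \<times> {1..k}"
  shows "constructible (NLC k) (add_edges (graph_union G J)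
           {(u, v). u \<in> pverts G \<and> v \<in> pverts J \<and> (l u, l v) \<in> S}) l"
proof -
  obtain l1 l2 where 1: "(G, l1) \<in> NLC k" "\<forall>v\<in>pverts G. l1 v = l v"
    and 2: "(J, l2) \<in> NLC k" "\<forall>v\<in>pverts J. l2 v = l v"
    using assms unfolding constructible_def by blast
  have "{(u, v). u \<in> pverts G \<and> v \<in> pverts J \<and> (l1 u, l2 v) \<in> S} =
      {(u, v). u \<in> pverts G \<and> v \<in> pverts J \<and> (l u, l v) \<in> S}"
    using 1 2 by auto
  with constructible_mem[OF NLC_union[OF 1(1) 2(1) assms(3,4)]] show ?thesis
    by (elim constructible_cong) (use 1 2 in \<open>auto simp: join_labels_def graph_simps\<close>)
qed

lemma constructible_NLC_relabel:
  assumes "constructible (NLC k) G l" "R ` {1..k} \<subseteq> {1..k}"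
  shows "constructible (NLC k) G (R \<circ> l)"
proof -
  obtain l1 where 1: "(G, l1) \<in> NLC k" "\<forall>v\<in>pverts G. l1 v = l v"
    using assms unfolding constructible_def by blast
  from constructible_mem[OF NLC_relabel[OF 1(1) assms(2)]] show ?thesis
    by (rule constructible_cong) (use 1 in auto)
qed

section \<open>Invariants of constructions\<close>

lemma CW_labels: "(G, l) \<in> CW k \<Longrightarrow> v \<in> pverts G \<Longrightarrow> l v \<in> {1..k}"
  by (induction rule: CW.induct) (auto simp: graph_simps join_labels_def)

lemma NLC_labels: "(G, l) \<in> NLC k \<Longrightarrow> v \<in> pverts G \<Longrightarrow> l v \<in> {1..k}"
  by (induction rule: NLC.induct) (auto simp: graph_simps join_labels_def image_subset_iff)

lemma CW_arcs: "(G, l) \<in> CW k \<Longrightarrow> parcs G \<subseteq> pverts G \<times> pverts G"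
  by (induction rule: CW.induct) (auto simp: graph_simps)

lemma NLC_arcs: "(G, l) \<in> NLC k \<Longrightarrow> parcs G \<subseteq> pverts G \<times> pverts G"
  by (induction rule: NLC.induct) (auto simp: graph_simps)

text \<open>A clique-width relabeling moves a single label, so merging all labels into
  \<open>k\<close> takes an induction that sends 1, 2, ..., \<open>k - 1\<close> to \<open>k\<close>
  in turn.\<close>

lemma constructible_CW_collapse:
  assumes "constructible (CW k) G l"
  shows "constructible (CW k) G (\<lambda>_. k)"
proof -
  have step: "constructible (CW k) G (\<lambda>v. if l v \<le> n then k else l v)" if "n < k" for n
    using that
  proof (induction n)
    case 0
    \<comment> \<open>Labels start at 1, so for \<open>n = 0\<close> nothing has been changed
      yet.\<close>
    from assms show ?case
      by (rule constructible_cong) (use assms CW_labels in \<open>fastforce simp: constructible_def\<close>)+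
  next
    case (Suc n)
    then have "constructible (CW k) G (\<lambda>v. if l v \<le> n then k else l v)" by simp
    then show ?case
      \<comment> \<open>\<open>Suc n < k\<close> makes the two labels distinct and leaves vertices
        already sent to \<open>k\<close> alone.\<close>
      by (rule constructible_cong[OF constructible_CW_relabel[of _ _ _ "Suc n" k]])
        (use Suc.prems in auto)
  qed
  have labels: "l v \<in> {1..k}" if "v \<in> pverts G" for v
    using assms CW_labels that unfolding constructible_def by metis
  show ?thesis
  proof (cases "k = 0")
    case True
    with assms show ?thesis
      by (elim constructible_cong) (use labels True in auto)
  next
    case False
    \<comment> \<open>Any label above \<open>k - 1\<close> is \<open>k\<close> itself, so this
      labeling is constant on the vertices.\<close>
    then have "constructible (CW k) G (\<lambda>v. if l v \<le> k - 1 then k else l v)" by (intro step) simp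
    then show ?thesis
      by (rule constructible_cong) (use labels in fastforce)+
  qed
qed

section \<open>Induced subgraphs\<close>

definition pullback :: "('w \<Rightarrow> 'v) \<Rightarrow> 'w set \<Rightarrow> 'v pair_pre_digraph \<Rightarrow> 'w pair_pre_digraph" where
  "pullback f W G = \<lparr>pverts = {u \<in> W. f u \<in> pverts G},
     parcs = {(u, v). u \<in> W \<and> v \<in> W \<and> (f u, f v) \<in> parcs G}\<rparr>"

lemma pullback_single_vertex:
  assumes "inj_on f W" "w \<in> W"
  shows "pullback f W (single_vertex (f w)) = single_vertex w"
  using assms by (auto simp: pullback_def single_vertex_def inj_on_def)

lemma pullback_graph_union:
  "pullback f W (graph_union G J) = graph_union (pullback f W G) (pullback f W J)"
  by (auto simp: pullback_def graph_union_def)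

lemma pullback_empty:
  assumes "parcs G \<subseteq> pverts G \<times> pverts G" "pverts (pullback f W G) = {}"
  shows "pullback f W G = \<lparr>pverts = {}, parcs = {}\<rparr>"
  using assms by (auto simp: pullback_def)

text \<open>Each construction step restricts to the same step on the chosen vertices. Allowing
  \<open>k'\<close> above \<open>k\<close> also provides monotonicity in the number of
  labels.\<close>

lemma constructible_CW_pullback:
  assumes "(G, l) \<in> CW k" "k \<le> k'" "inj_on f W" "pverts (pullback f W G) \<noteq> {}"
  shows "constructible (CW k') (pullback f W G) (l \<circ> f)"
  using assms(1,4)
proof (induction rule: CW.induct)
  case (CW_vertex l v)
  then obtain w where "w \<in> W" "v = f w"
    by (auto simp: pullback_def single_vertex_def)
  with CW_vertex assms(2,3) show ?case
    by (auto simp: pullback_single_vertex intro!: constructible_CW_vertex)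
next
  case (CW_union G l J l')
  let ?l = "join_labels G l l' \<circ> f"
  have left: "constructible (CW k') (pullback f W G) ?l" if "pverts (pullback f W G) \<noteq> {}"
    using CW_union.IH(1)[OF that]
    by (rule constructible_cong) (auto simp: pullback_def join_labels_def)
  have right: "constructible (CW k') (pullback f W J) ?l" if "pverts (pullback f W J) \<noteq> {}"
    using CW_union.IH(2)[OF that]
    by (rule constructible_cong) (use CW_union.hyps in \<open>auto simp: pullback_def join_labels_def\<close>)
  \<comment> \<open>The empty graph has no construction, so a union with an operand that loses all
    its vertices is skipped and the other operand's construction is reused.\<close>
  consider (G) "pverts (pullback f W G) = {}" | (J) "pverts (pullback f W J) = {}"
    | (both) "pverts (pullback f W G) \<noteq> {}" "pverts (pullback f W J) \<noteq> {}" by blast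
  then show ?case
  proof cases
    case G
    then have "pullback f W (graph_union G J) = pullback f W J"
      using pullback_empty[OF CW_arcs[OF CW_union.hyps(1)] G]
      unfolding pullback_graph_union by (simp add: graph_union_def)
    with right CW_union.prems show ?thesis by (simp add: comp_def)
  next
    case J
    then have "pullback f W (graph_union G J) = pullback f W G"
      using pullback_empty[OF CW_arcs[OF CW_union.hyps(2)] J]
      unfolding pullback_graph_union by (simp add: graph_union_def)
    with left CW_union.prems show ?thesis by (simp add: comp_def)
  next
    case both
    with CW_union.hyps show ?thesis
      unfolding pullback_graph_union
      by (intro constructible_CW_union left right) (auto simp: pullback_def)
  qed
next
  case (CW_relabel G l a b)
  then have "constructible (CW k') (pullback f W G) (\<lambda>v. if (l \<circ> f) v = a then b else (l \<circ> f) v)"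
    using assms(2) by (intro constructible_CW_relabel) auto
  then show ?case by (rule constructible_cong) auto
next
  case (CW_join G l a b)
  then have "constructible (CW k') (pullback f W G) (l \<circ> f)"
    by (simp add: pullback_def add_edges_def comp_def)
  then show ?case
    by (rule constructible_cong[OF constructible_CW_join[of _ _ _ a b]])
      (use CW_join.hyps assms(2) in \<open>auto simp: pullback_def add_edges_def\<close>)
qed

text \<open>As for clique-width. Edges added by a union have one end in each operand, so they vanish
  together with an emptied operand.\<close>

lemma constructible_NLC_pullback:
  assumes "(G, l) \<in> NLC k" "k \<le> k'" "inj_on f W" "pverts (pullback f W G) \<noteq> {}"
  shows "constructible (NLC k') (pullback f W G) (l \<circ> f)"
  using assms(1,4)
proof (induction rule: NLC.induct)
  case (NLC_vertex l v)
  then obtain w where "w \<in> W" "v = f w"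
    by (auto simp: pullback_def single_vertex_def)
  with NLC_vertex assms(2,3) show ?case
    by (auto simp: pullback_single_vertex intro!: constructible_NLC_vertex)
next
  case (NLC_union G l J l' S)
  let ?l = "join_labels G l l' \<circ> f"
  let ?E = "{(u, v). u \<in> pverts G \<and> v \<in> pverts J \<and> (l u, l' v) \<in> S}"
  have left: "constructible (NLC k') (pullback f W G) ?l" if "pverts (pullback f W G) \<noteq> {}"
    using NLC_union.IH(1)[OF that]
    by (rule constructible_cong) (auto simp: pullback_def join_labels_def)
  have right: "constructible (NLC k') (pullback f W J) ?l" if "pverts (pullback f W J) \<noteq> {}"
    using NLC_union.IH(2)[OF that]
    by (rule constructible_cong) (use NLC_union.hyps in \<open>auto simp: pullback_def join_labels_def\<close>)
  consider (G) "pverts (pullback f W G) = {}" | (J) "pverts (pullback f W J) = {}"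
    | (both) "pverts (pullback f W G) \<noteq> {}" "pverts (pullback f W J) \<noteq> {}" by blast
  then show ?case
  proof cases
    case G
    then have "pullback f W (add_edges (graph_union G J) ?E) = pullback f W J"
      using pullback_empty[OF NLC_arcs[OF NLC_union.hyps(1)] G]
      by (auto simp: pullback_def graph_simps)
    with right NLC_union.prems show ?thesis by (simp add: comp_def)
  next
    case J
    then have "pullback f W (add_edges (graph_union G J) ?E) = pullback f W G"
      using pullback_empty[OF NLC_arcs[OF NLC_union.hyps(2)] J]
      by (auto simp: pullback_def graph_simps)
    with left NLC_union.prems show ?thesis by (simp add: comp_def)
  next
    case both
    have "pverts (pullback f W G) \<inter> pverts (pullback f W J) = {}" "S \<subseteq> {1..k'} \<times> {1..k'}"
      using NLC_union.hyps assms(2) by (auto simp: pullback_def)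
    from constructible_NLC_union[OF left[OF both(1)] right[OF both(2)] this] show ?thesis
      by (rule constructible_cong)
        (use NLC_union.hyps in \<open>auto simp: pullback_def graph_simps join_labels_def\<close>)
  qed
next
  case (NLC_relabel G l R)
  \<comment> \<open>\<open>R\<close> is only controlled on \<open>{1..k}\<close> and could leave
    \<open>{1..k'}\<close> elsewhere; the identity extends it safely, and vertices of
    \<open>G\<close> carry labels in \<open>{1..k}\<close> only.\<close>
  let ?R = "\<lambda>i. if i \<in> {1..k} then R i else i"
  have "R i \<in> {1..k}" if "i \<in> {1..k}" for i
    using NLC_relabel.hyps(2) that by blast
  then have R: "?R ` {1..k'} \<subseteq> {1..k'}"
    using assms(2) by fastforce
  have "constructible (NLC k') (pullback f W G) (?R \<circ> (l \<circ> f))"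
    using NLC_relabel.IH[OF NLC_relabel.prems] by (rule constructible_NLC_relabel) (rule R)
  then show ?case
    by (rule constructible_cong)
      (use NLC_labels[OF NLC_relabel.hyps(1)] in \<open>auto simp: pullback_def\<close>)
qed

section \<open>Existence of constructions\<close>

text \<open>Give every vertex its own label; then each edge can be added alone by joining the labels
  of its ends. This ensures that the \<open>LEAST\<close> defining the width is attained.\<close>

lemma ex_constructible_CW:
  assumes "pair_graph G" "pverts G \<noteq> {}"
  shows "\<exists>k>0. \<exists>l. (G, l) \<in> CW k"
proof -
  interpret pair_graph G by fact
  obtain l where "bij_betw l (pverts G) {1..card (pverts G)}"
    using pair_finite_verts finite_same_card_bij[of "pverts G" "{1..card (pverts G)}"] by auto
  then have inj: "inj_on l (pverts G)" and l: "\<And>v. v \<in> pverts G \<Longrightarrow> l v \<in> {1..card (pverts G)}"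
    by (auto simp: bij_betw_def)
  let ?C = "CW (card (pverts G))"
  have verts: "constructible ?C \<lparr>pverts = W, parcs = {}\<rparr> l"
    if "finite W" "W \<noteq> {}" "W \<subseteq> pverts G" for W
    using that
  proof (induction rule: finite_ne_induct)
    case (singleton v)
    then show ?case
      using constructible_CW_vertex[of l v] l[of v] by (simp add: single_vertex_def)
  next
    case (insert v W)
    then have "constructible ?C (graph_union (single_vertex v) \<lparr>pverts = W, parcs = {}\<rparr>) l"
      by (intro constructible_CW_union constructible_CW_vertex l) (auto simp: single_vertex_def)
    then show ?case by (simp add: graph_simps)
  qed
  \<comment> \<open>A join adds both directions, so the arc set grows in symmetrized form; for
    \<open>E = parcs G\<close> symmetry returns \<open>G\<close>.\<close>
  have edges: "constructible ?C \<lparr>pverts = pverts G, parcs = E \<union> E\<inverse>\<rparr> l"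
    if "finite E" "E \<subseteq> parcs G" for E
    using that
  proof (induction rule: finite_induct)
    case empty
    then show ?case using verts assms(2) pair_finite_verts by simp
  next
    case (insert e E)
    obtain u v where e: "e = (u, v)" by fastforce
    with insert.prems have uv: "u \<in> pverts G" "v \<in> pverts G" "u \<noteq> v"
      using in_arcsD1 in_arcsD2 no_loops' by auto
    then have "l u \<noteq> l v" using inj by (auto simp: inj_on_def)
    moreover have "{(u', v'). u' \<in> pverts G \<and> v' \<in> pverts G \<and> l u' = l u \<and> l v' = l v} = {(u, v)}"
      using uv inj by (auto simp: inj_on_def)
    moreover have "constructible ?C \<lparr>pverts = pverts G, parcs = E \<union> E\<inverse>\<rparr> l"
      using insert by auto
    ultimately have "constructible ?C
        (add_edges \<lparr>pverts = pverts G, parcs = E \<union> E\<inverse>\<rparr> {(u, v)}) l"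
      using constructible_CW_join[of _ "\<lparr>pverts = pverts G, parcs = E \<union> E\<inverse>\<rparr>" l "l u" "l v"] l uv
      by simp
    then show ?case
      by (rule constructible_cong) (auto simp: e add_edges_def)
  qed
  have "parcs G \<union> (parcs G)\<inverse> = parcs G"
    using arcs_symmetric by auto
  with edges[OF pair_finite_arcs order_refl] have "constructible ?C G l"
    by (elim constructible_cong) (auto intro!: pair_pre_digraph.equality)
  moreover have "card (pverts G) > 0" using assms(2) pair_finite_verts by auto
  ultimately show ?thesis unfolding constructible_def by blast
qed

text \<open>NLC adds edges only during a union, so distinctly labeled vertices are inserted one by
  one, each with its edges to those already present. The invariant is the induced subgraph on
  \<open>W\<close>.\<close>

lemma ex_constructible_NLC:
  assumes "pair_graph G" "pverts G \<noteq> {}"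
  shows "\<exists>k>0. \<exists>l. (G, l) \<in> NLC k"
proof -
  interpret pair_graph G by fact
  obtain l where "bij_betw l (pverts G) {1..card (pverts G)}"
    using pair_finite_verts finite_same_card_bij[of "pverts G" "{1..card (pverts G)}"] by auto
  then have inj: "inj_on l (pverts G)" and l: "\<And>v. v \<in> pverts G \<Longrightarrow> l v \<in> {1..card (pverts G)}"
    by (auto simp: bij_betw_def)
  let ?C = "NLC (card (pverts G))"
  have "constructible ?C \<lparr>pverts = W, parcs = parcs G \<inter> W \<times> W\<rparr> l"
    if "finite W" "W \<noteq> {}" "W \<subseteq> pverts G" for W
    using that
  proof (induction rule: finite_ne_induct)
    case (singleton v)
    then have "constructible ?C (single_vertex v) l"
      by (intro constructible_NLC_vertex l) simp
    then show ?case
      by (rule constructible_cong) (auto simp: single_vertex_def dest: no_loops')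
  next
    case (insert v W)
    \<comment> \<open>The label of \<open>v\<close> paired with those of its neighbours in
      \<open>W\<close>; injectivity of \<open>l\<close> makes this select exactly those
      edges.\<close>
    let ?S = "{(l v, l w) | w. w \<in> W \<and> (v, w) \<in> parcs G}"
    let ?W = "\<lparr>pverts = W, parcs = parcs G \<inter> W \<times> W\<rparr>"
    have v: "constructible ?C (single_vertex v) l"
      using insert.prems by (intro constructible_NLC_vertex l) auto
    have W: "constructible ?C ?W l" using insert by auto
    have "pverts (single_vertex v) \<inter> pverts ?W = {}"
      "?S \<subseteq> {1..card (pverts G)} \<times> {1..card (pverts G)}"
      using insert l by (auto simp: single_vertex_def)
    note union = constructible_NLC_union[OF v W this]
    have "{(u, w). u \<in> pverts (single_vertex v) \<and> w \<in> pverts ?W \<and> (l u, l w) \<in> ?S} =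
        {(v, w) | w. w \<in> W \<and> (v, w) \<in> parcs G}"
      using insert.prems inj by (auto simp: single_vertex_def inj_on_def)
    moreover have "add_edges (graph_union (single_vertex v) ?W)
        {(v, w) | w. w \<in> W \<and> (v, w) \<in> parcs G} =
        \<lparr>pverts = insert v W, parcs = parcs G \<inter> insert v W \<times> insert v W\<rparr>"
      using arcs_symmetric no_loops' by (auto simp: graph_simps)
    ultimately show ?case using union by simp
  qed
  from this[OF pair_finite_verts assms(2) order_refl] have "constructible ?C G l"
    by (rule constructible_cong) (auto intro!: pair_pre_digraph.equality dest: in_arcsD1 in_arcsD2)
  moreover have "card (pverts G) > 0" using assms(2) pair_finite_verts by auto
  ultimately show ?thesis unfolding constructible_def by blast
qed

section \<open>Coronas\<close>

lemma pverts_corona: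
  "pverts (corona G1 G2) = Inl ` pverts G1 \<union> Inr ` (pverts G1 \<times> pverts G2)"
  by (simp add: corona_def add_edges_def)

lemma parcs_corona:
  "parcs (corona G1 G2) =
    {(Inl x, Inl x') | x x'. (x, x') \<in> parcs G1} \<union>
    {(Inr (x, y), Inr (x, y')) | x y y'. x \<in> pverts G1 \<and> (y, y') \<in> parcs G2} \<union>
    {(Inl x, Inr (x, y)) | x y. x \<in> pverts G1 \<and> y \<in> pverts G2} \<union>
    {(Inr (x, y), Inl x) | x y. x \<in> pverts G1 \<and> y \<in> pverts G2}"
  by (auto simp: corona_def add_edges_def)

lemma pullback_Inl_corona:
  assumes "parcs G1 \<subseteq> pverts G1 \<times> pverts G1"
  shows "pullback Inl (pverts G1) (corona G1 G2) = G1"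
  using assms by (intro pair_pre_digraph.equality) (auto simp: pullback_def pverts_corona parcs_corona)

lemma pullback_Inr_corona:
  assumes "parcs G2 \<subseteq> pverts G2 \<times> pverts G2" "x \<in> pverts G1"
  shows "pullback (\<lambda>y. Inr (x, y)) (pverts G2) (corona G1 G2) = G2"
  using assms by (intro pair_pre_digraph.equality) (auto simp: pullback_def pverts_corona parcs_corona)

text \<open>The copy of \<open>G\<close> attached to \<open>x\<close>. As a pullback along
  \<open>Inr (x, y)\<close> \<mapsto> \<open>y\<close> it inherits a construction from
  \<open>G\<close>.\<close>

definition fibre_copy :: "'a \<Rightarrow> 'b pair_pre_digraph \<Rightarrow> ('a + 'a \<times> 'b) pair_pre_digraph" where
  "fibre_copy x G = pullback (\<lambda>w. snd (projr w)) (Inr ` ({x} \<times> pverts G)) G"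

lemma inj_on_fibre: "inj_on (\<lambda>w. snd (projr w)) (Inr ` ({x} \<times> V))"
  by (auto simp: inj_on_def)

lemma pverts_fibre_copy: "pverts (fibre_copy x G) = Inr ` ({x} \<times> pverts G)"
  by (auto simp: fibre_copy_def pullback_def)

lemma parcs_fibre_copy:
  assumes "parcs G \<subseteq> pverts G \<times> pverts G"
  shows "parcs (fibre_copy x G) = {(Inr (x, y), Inr (x, y')) | y y'. (y, y') \<in> parcs G}"
  using assms by (auto simp: fibre_copy_def pullback_def)

text \<open>Base case for lifting a construction of \<open>G1\<close>: the vertex is joined
  completely to its only copy.\<close>

lemma corona_single_vertex:
  assumes "parcs G \<subseteq> pverts G \<times> pverts G"
  shows "corona (single_vertex x) G =
    add_edges (graph_union (single_vertex (Inl x)) (fibre_copy x G)) ({Inl x} \<times> Inr ` ({x} \<times> pverts G))"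
  by (intro pair_pre_digraph.equality)
    (auto simp: pverts_corona parcs_corona graph_simps pverts_fibre_copy parcs_fibre_copy[OF assms])

lemma corona_graph_union:
  "corona (graph_union G J) H = graph_union (corona G H) (corona J H)"
  by (intro pair_pre_digraph.equality) (auto simp: pverts_corona parcs_corona graph_union_def)

text \<open>New edges of the first graph run between \<open>Inl\<close> vertices only, so
  edge-adding steps lift to the corona.\<close>

lemma corona_add_edges:
  "corona (add_edges G E) H = add_edges (corona G H) (map_prod Inl Inl ` E)"
  by (intro pair_pre_digraph.equality) (auto simp: pverts_corona parcs_corona add_edges_def)

text \<open>The stated labeling is the induction invariant: \<open>Inl x\<close> keeps its label
  from \<open>G1\<close>, all copies carry \<open>K\<close>. Here \<open>k1 < K\<close> reserves
  \<open>K\<close>, and \<open>k2 \<le> K\<close> leaves enough labels to build a copy before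
  collapsing it.\<close>

lemma constructible_CW_corona:
  assumes "(G1, l1) \<in> CW k1" "(G2, l2) \<in> CW k2" "k1 < K" "k2 \<le> K" "pverts G2 \<noteq> {}"
  shows "constructible (CW K) (corona G1 G2) (case_sum l1 (\<lambda>_. K))"
  using assms(1)
proof (induction rule: CW.induct)
  case (CW_vertex l x)
  let ?l = "case_sum l (\<lambda>_. K) :: 'a + 'a \<times> 'b \<Rightarrow> nat"
  have "constructible (CW K) (fibre_copy x G2) (l2 \<circ> (\<lambda>w. snd (projr w)))"
    unfolding fibre_copy_def
    using assms pverts_fibre_copy[of x G2, unfolded fibre_copy_def]
    by (intro constructible_CW_pullback inj_on_fibre) auto
  from constructible_CW_collapse[OF this]
  have "constructible (CW K) (fibre_copy x G2) ?l"
    by (rule constructible_cong) (auto simp: pverts_fibre_copy)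
  then have "constructible (CW K) (graph_union (single_vertex (Inl x)) (fibre_copy x G2)) ?l"
    using CW_vertex assms(3)
    by (intro constructible_CW_union constructible_CW_vertex)
      (auto simp: single_vertex_def pverts_fibre_copy)
  then show ?case
    unfolding corona_single_vertex[OF CW_arcs[OF assms(2)]]
    \<comment> \<open>\<open>Inl x\<close> alone has label \<open>l x < K\<close>, so this join
      links it to exactly its copy.\<close>
    by (rule constructible_cong[OF constructible_CW_join[of _ _ _ "l x" K]])
      (use CW_vertex assms(3) in \<open>auto simp: graph_simps pverts_fibre_copy\<close>)
next
  case (CW_union G l J l')
  let ?l = "case_sum (join_labels G l l') (\<lambda>_. K) :: 'a + 'a \<times> 'b \<Rightarrow> nat"
  have "constructible (CW K) (corona G G2) ?l"
    using CW_union.IH(1) by (rule constructible_cong) (auto simp: pverts_corona join_labels_def)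
  moreover have "constructible (CW K) (corona J G2) ?l"
    using CW_union.IH(2) CW_union.hyps
    by (elim constructible_cong) (auto simp: pverts_corona join_labels_def)
  ultimately show ?case
    unfolding corona_graph_union using CW_union.hyps
    by (intro constructible_CW_union) (auto simp: pverts_corona)
next
  \<comment> \<open>Here and in the join case \<open>a\<close> and \<open>b\<close> are at most
    \<open>k1 < K\<close>, so only \<open>Inl\<close> vertices are affected.\<close>
  case (CW_relabel G l a b)
  show ?case
    by (rule constructible_cong[OF constructible_CW_relabel[OF CW_relabel.IH, of a b]])
      (use CW_relabel.hyps assms(3) in \<open>auto simp: pverts_corona\<close>)
next
  case (CW_join G l a b)
  show ?case
    unfolding corona_add_edges
    by (rule constructible_cong[OF constructible_CW_join[OF CW_join.IH, of a b]])
      (use CW_join.hyps assms(3) in \<open>auto simp: pverts_corona intro!: arg_cong2[where f = add_edges]\<close>)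
qed

text \<open>Same invariant as for clique-width, but a single constant relabeling collapses a copy,
  and the attaching edges arise in the union itself.\<close>

lemma constructible_NLC_corona:
  assumes "(G1, l1) \<in> NLC k1" "(G2, l2) \<in> NLC k2" "k1 < K" "k2 \<le> K" "pverts G2 \<noteq> {}"
  shows "constructible (NLC K) (corona G1 G2) (case_sum l1 (\<lambda>_. K))"
  using assms(1)
proof (induction rule: NLC.induct)
  case (NLC_vertex l x)
  let ?l = "case_sum l (\<lambda>_. K) :: 'a + 'a \<times> 'b \<Rightarrow> nat"
  have "constructible (NLC K) (fibre_copy x G2) (l2 \<circ> (\<lambda>w. snd (projr w)))"
    unfolding fibre_copy_def
    using assms pverts_fibre_copy[of x G2, unfolded fibre_copy_def]
    by (intro constructible_NLC_pullback inj_on_fibre) auto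
  then have copy: "constructible (NLC K) (fibre_copy x G2) ?l"
    by (rule constructible_cong[OF constructible_NLC_relabel[of _ _ _ "\<lambda>_. K"]])
      (use assms(3) in \<open>auto simp: pverts_fibre_copy\<close>)
  have "constructible (NLC K) (single_vertex (Inl x)) ?l"
    using NLC_vertex assms(3) by (intro constructible_NLC_vertex) auto
  then show ?case
    unfolding corona_single_vertex[OF NLC_arcs[OF assms(2)]]
    by (rule constructible_cong[OF constructible_NLC_union[OF _ copy, of _ "{(l x, K)}"]])
      (use NLC_vertex assms(3) in \<open>auto simp: graph_simps pverts_fibre_copy\<close>)
next
  case (NLC_union G l J l' S)
  let ?l = "case_sum (join_labels G l l') (\<lambda>_. K) :: 'a + 'a \<times> 'b \<Rightarrow> nat"
  have G: "constructible (NLC K) (corona G G2) ?l"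
    using NLC_union.IH(1) by (rule constructible_cong) (auto simp: pverts_corona join_labels_def)
  have J: "constructible (NLC K) (corona J G2) ?l"
    using NLC_union.IH(2) NLC_union.hyps
    by (elim constructible_cong) (auto simp: pverts_corona join_labels_def)
  have "pverts (corona G G2) \<inter> pverts (corona J G2) = {}" "S \<subseteq> {1..K} \<times> {1..K}"
    using NLC_union.hyps assms(3) by (fastforce simp: pverts_corona)+
  note union = constructible_NLC_union[OF G J this]
  \<comment> \<open>\<open>S\<close> lies in the square of \<open>{1..k1}\<close>, so no edge meets
    a copy vertex.\<close>
  have S: "(i, K) \<notin> S" "(K, i) \<notin> S" for i
    using NLC_union.hyps assms(3) by auto
  have "v \<notin> pverts G" if "v \<in> pverts J" for v
    using NLC_union.hyps that by blast
  with S have "{(u, v). u \<in> pverts (corona G G2) \<and> v \<in> pverts (corona J G2) \<and> (?l u, ?l v) \<in> S} =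
      map_prod Inl Inl ` {(u, v). u \<in> pverts G \<and> v \<in> pverts J \<and> (l u, l' v) \<in> S}"
    by (auto simp: pverts_corona join_labels_def)
  with union show ?case
    unfolding corona_add_edges corona_graph_union by simp
next
  case (NLC_relabel G l R)
  \<comment> \<open>\<open>R K\<close> is arbitrary; replacing \<open>R\<close> by the identity
    outside \<open>{1..k1}\<close> fixes \<open>K\<close> and keeps labels within
    \<open>{1..K}\<close>.\<close>
  let ?R = "\<lambda>i. if i \<in> {1..k1} then R i else i"
  have "R i \<in> {1..k1}" if "i \<in> {1..k1}" for i
    using NLC_relabel.hyps(2) that by blast
  then have R: "?R ` {1..K} \<subseteq> {1..K}"
    using assms(3) by fastforce
  have "constructible (NLC K) (corona G G2) (?R \<circ> case_sum l (\<lambda>_. K))"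
    using NLC_relabel by (intro constructible_NLC_relabel R) auto
  then show ?case
    by (rule constructible_cong)
      (use NLC_labels[OF NLC_relabel.hyps(1)] assms(3) in \<open>auto simp: pverts_corona\<close>)
qed

section \<open>Width bounds\<close>

lemma clique_width_le: "(G, l) \<in> CW k \<Longrightarrow> 0 < k \<Longrightarrow> clique_width G \<le> k"
  unfolding clique_width_def by (intro Least_le) blast

lemma nlc_width_le: "(G, l) \<in> NLC k \<Longrightarrow> 0 < k \<Longrightarrow> nlc_width G \<le> k"
  unfolding nlc_width_def by (intro Least_le) blast

lemma clique_width_attained:
  assumes "(G, l) \<in> CW k" "0 < k"
  obtains l' where "0 < clique_width G" "(G, l') \<in> CW (clique_width G)"
  using assms LeastI[of "\<lambda>k. 0 < k \<and> (\<exists>l. (G, l) \<in> CW k)" k] that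
  unfolding clique_width_def by blast

lemma nlc_width_attained:
  assumes "(G, l) \<in> NLC k" "0 < k"
  obtains l' where "0 < nlc_width G" "(G, l') \<in> NLC (nlc_width G)"
  using assms LeastI[of "\<lambda>k. 0 < k \<and> (\<exists>l. (G, l) \<in> NLC k)" k] that
  unfolding nlc_width_def by blast

text \<open>The given construction guarantees that the width of \<open>G\<close> is attained; an
  optimal construction is then restricted.\<close>

lemma clique_width_pullback_le:
  assumes "(G, l) \<in> CW k" "0 < k" "inj_on f W" "pverts (pullback f W G) \<noteq> {}"
  shows "clique_width (pullback f W G) \<le> clique_width G"
proof -
  obtain l' where "0 < clique_width G" "(G, l') \<in> CW (clique_width G)"
    using assms(1,2) by (rule clique_width_attained)
  with constructible_CW_pullback[OF this(2) order_refl assms(3,4)] show ?thesis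
    unfolding constructible_def by (blast intro: clique_width_le)
qed

lemma nlc_width_pullback_le:
  assumes "(G, l) \<in> NLC k" "0 < k" "inj_on f W" "pverts (pullback f W G) \<noteq> {}"
  shows "nlc_width (pullback f W G) \<le> nlc_width G"
proof -
  obtain l' where "0 < nlc_width G" "(G, l') \<in> NLC (nlc_width G)"
    using assms(1,2) by (rule nlc_width_attained)
  with constructible_NLC_pullback[OF this(2) order_refl assms(3,4)] show ?thesis
    unfolding constructible_def by (blast intro: nlc_width_le)
qed

lemma clique_width_corona:
  assumes "pair_graph G1" "pair_graph G2" "pverts G1 \<noteq> {}" "pverts G2 \<noteq> {}"
  defines "m \<equiv> max (clique_width G1) (clique_width G2)"
  shows "m \<le> clique_width (corona G1 G2)" "clique_width (corona G1 G2) \<le> m + 1"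
proof -
  obtain l1 where l1: "(G1, l1) \<in> CW (clique_width G1)"
    using ex_constructible_CW[OF assms(1,3)] by (metis clique_width_attained)
  obtain l2 where l2: "(G2, l2) \<in> CW (clique_width G2)"
    using ex_constructible_CW[OF assms(2,4)] by (metis clique_width_attained)
  obtain l where l: "(corona G1 G2, l) \<in> CW (m + 1)"
    using constructible_CW_corona[OF l1 l2, of "m + 1"] assms(4)
    unfolding m_def constructible_def by force
  then show "clique_width (corona G1 G2) \<le> m + 1"
    by (rule clique_width_le) simp
  obtain x where x: "x \<in> pverts G1" using assms(3) by blast
  have inj: "inj_on (\<lambda>y. Inr (x, y)) (pverts G2)" by (simp add: inj_on_def)
  \<comment> \<open>The construction behind the upper bound also witnesses that the width of the
    corona is attained, as the lower bound requires.\<close>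
  note le = clique_width_pullback_le[OF l add_nonneg_pos[OF le0 zero_less_one]]
  show "m \<le> clique_width (corona G1 G2)"
    using le[of Inl "pverts G1"] le[OF inj] assms(3,4)
    by (simp add: m_def pullback_Inl_corona[OF CW_arcs[OF l1]] pullback_Inr_corona[OF CW_arcs[OF l2] x])
qed

lemma nlc_width_corona:
  assumes "pair_graph G1" "pair_graph G2" "pverts G1 \<noteq> {}" "pverts G2 \<noteq> {}"
  defines "m \<equiv> max (nlc_width G1) (nlc_width G2)"
  shows "m \<le> nlc_width (corona G1 G2)" "nlc_width (corona G1 G2) \<le> m + 1"
proof -
  obtain l1 where l1: "(G1, l1) \<in> NLC (nlc_width G1)"
    using ex_constructible_NLC[OF assms(1,3)] nlc_width_attained by metis
  obtain l2 where l2: "(G2, l2) \<in> NLC (nlc_width G2)"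
    using ex_constructible_NLC[OF assms(2,4)] nlc_width_attained by metis
  obtain l where l: "(corona G1 G2, l) \<in> NLC (m + 1)"
    using constructible_NLC_corona[OF l1 l2, of "m + 1"] assms(4)
    unfolding m_def constructible_def by force
  then show "nlc_width (corona G1 G2) \<le> m + 1"
    by (rule nlc_width_le) simp
  obtain x where x: "x \<in> pverts G1" using assms(3) by blast
  have inj: "inj_on (\<lambda>y. Inr (x, y)) (pverts G2)" by (simp add: inj_on_def)
  note le = nlc_width_pullback_le[OF l add_nonneg_pos[OF le0 zero_less_one]]
  show "m \<le> nlc_width (corona G1 G2)"
    \<comment> \<open>Pulling back along \<open>Inl\<close> gives \<open>G1\<close>; along the copy
      at the chosen \<open>x\<close> it gives \<open>G2\<close>.\<close>
    using le[of Inl "pverts G1"] le[OF inj] assms(3,4)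
    by (simp add: m_def pullback_Inl_corona[OF NLC_arcs[OF l1]] pullback_Inr_corona[OF NLC_arcs[OF l2] x])
qed

theorem theorem2:
  fixes G1 :: "'a pair_pre_digraph" and G2 :: "'b pair_pre_digraph"
  assumes "pair_graph G1" and "pair_graph G2"
    and "pverts G1 \<noteq> {}" and "pverts G2 \<noteq> {}"
  defines "m1 \<equiv> max (nlc_width G1) (nlc_width G2)"
    and "m2 \<equiv> max (clique_width G1) (clique_width G2)"
  shows "m1 \<le> nlc_width (corona G1 G2) \<and> nlc_width (corona G1 G2) \<le> m1 + 1 \<and>
         m2 \<le> clique_width (corona G1 G2) \<and> clique_width (corona G1 G2) \<le> m2 + 1"
  unfolding m1_def m2_def
  using nlc_width_corona[OF assms(1-4)] clique_width_corona[OF assms(1-4)] by blast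

end
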